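(* Let $G$ be a graph on $n$ vertices, let $k$ be an integer with $1\le k\le \frac n2$, and let $F_k=F_k(G)$ be its $k$-token graph. Let $L_1$ and $L_k$ be the Laplacian matrices of $G$ and $F_k$, respectively, and let $B$ be the $(n;k)$-binomial matrix. Then $$B^{\top} L_k B=\binom{n-2}{k-1}L_1 .$$
   Context: All graphs are finite and simple. For a graph $G$ with vertex set $[n]=\{1,\dots,n\}$ and $1\le k\le n$, the $k$-token graph $F_k(G)$ has as vertices the $k$-subsets of $[n]$; two vertices $A,B$ are adjacent iff $A\bigtriangleup B=\{a,b\}$ with $a\in A$, $b\in B$ and $\{a,b\}$ an edge of $G$. The Laplacian matrix of a graph is the diagonal degree matrix minus the adjacency matrix. The $(n;k)$-binomial matrix $B$ is the $\binom nk\times n$ $(0,1)$-matrix whose rows are the characteristic vectors of the $k$-subsets of $[n]$: for a $k$-subset $A$ and $j\in[n]$, $B_{Aj}=1$ if $j\in A$ and $B_{Aj}=0$ otherwise. The rows of $B$ and the rows and columns of $L_k$ are indexed by the $k$-subsets in the same order. *)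

theory Defs
  imports "Graph_Theory.Pair_Digraph" "Jordan_Normal_Form.Matrix" Complex_Main
begin

text \<open>
  A finite simple graph is a \<^locale>\<open>pair_graph\<close>: a finite, loop-free, symmetric set of
  ordered pairs, so that an edge \<open>{a, b}\<close> is the pair of arcs \<open>(a, b)\<close>, \<open>(b, a)\<close>.
\<close>

definition k_subsets :: "'a set \<Rightarrow> nat \<Rightarrow> 'a set set" where
  "k_subsets V k = {A. A \<subseteq> V \<and> card A = k}"

definition token_graph :: "nat \<Rightarrow> 'a pair_pre_digraph \<Rightarrow> 'a set pair_pre_digraph" where
  "token_graph k G =
     \<lparr> pverts = k_subsets (pverts G) k,
       parcs = {(A, B). A \<in> k_subsets (pverts G) k \<and> B \<in> k_subsets (pverts G) k \<and>
                  (\<exists>a\<in>A. \<exists>b\<in>B. sym_diff A B = {a, b} \<and> (a, b) \<in> parcs G)} \<rparr>"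

lemma pair_graph_token_graph:
  assumes "pair_graph G"
  shows "pair_graph (token_graph k G)"
proof -
  interpret pair_graph G by fact
  let ?K = "k_subsets (pverts G) k"
  have fin: "finite ?K"
    unfolding k_subsets_def using pair_finite_verts by simp
  have "parcs (token_graph k G) \<subseteq> ?K \<times> ?K"
    by (auto simp: token_graph_def)
  then have finarcs: "finite (parcs (token_graph k G))"
    by (rule finite_subset) (intro finite_cartesian_product fin)
  have "sym (parcs (token_graph k G))"
  proof (rule symI)
    fix A B assume "(A, B) \<in> parcs (token_graph k G)"
    then obtain a b where ab: "A \<in> ?K" "B \<in> ?K" "a \<in> A" "b \<in> B"
        "sym_diff A B = {a, b}" "(a, b) \<in> parcs G"
      by (auto simp: token_graph_def)
    have "sym_diff B A = {b, a}" using ab(5) by blast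
    moreover have "(b, a) \<in> parcs G" using ab(6) by (rule arcs_symmetric)
    ultimately show "(B, A) \<in> parcs (token_graph k G)"
      using ab(1-4) unfolding token_graph_def by auto
  qed
  then have "symmetric (with_proj (token_graph k G))"
    by (simp add: symmetric_def)
  moreover have "fst e \<noteq> snd e" if "e \<in> parcs (token_graph k G)" for e
    using that by (cases e) (auto simp: token_graph_def)
  moreover have "fst e \<in> pverts (token_graph k G)" "snd e \<in> pverts (token_graph k G)"
    if "e \<in> parcs (token_graph k G)" for e
    using that by (cases e; simp add: token_graph_def)+
  moreover have "finite (pverts (token_graph k G))"
    using fin by (simp add: token_graph_def)
  ultimately show ?thesis
    using finarcs by unfold_locales
qed

text \<open>
  Matrices are indexed by positions in a list \<open>vs\<close> that enumerates the vertices. In a symmetric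
  digraph, the out-degree of a vertex is its degree as an undirected graph.
\<close>

definition degree_matrix :: "'a list \<Rightarrow> 'a pair_pre_digraph \<Rightarrow> real mat" where
  "degree_matrix vs G = mat (length vs) (length vs)
     (\<lambda>(i, j). if i = j then real (out_degree (with_proj G) (vs ! i)) else 0)"

definition adjacency_matrix :: "'a list \<Rightarrow> 'a pair_pre_digraph \<Rightarrow> real mat" where
  "adjacency_matrix vs G = mat (length vs) (length vs)
     (\<lambda>(i, j). if (vs ! i, vs ! j) \<in> parcs G then 1 else 0)"

definition laplacian_matrix :: "'a list \<Rightarrow> 'a pair_pre_digraph \<Rightarrow> real mat" where
  "laplacian_matrix vs G = degree_matrix vs G - adjacency_matrix vs G"

text \<open>
  Rows follow the enumeration \<open>As\<close> of the \<open>k\<close>-subsets of \<open>{1..n}\<close>; the matrix indices start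
  at 0, so column \<open>j\<close> belongs to the element \<open>Suc j\<close>.
\<close>

definition binomial_matrix :: "nat \<Rightarrow> nat \<Rightarrow> nat set list \<Rightarrow> real mat" where
  "binomial_matrix n k As = mat (n choose k) n
     (\<lambda>(i, j). if Suc j \<in> As ! i then 1 else 0)"

end

theory Submission
  imports Defs
begin

text \<open>
  Both Laplacians are evaluated through the form
  \<open>\<Sum>\<^sub>u\<^sub>v f(u) L(u,v) g(v) = \<Sum> f(u) (g(u) - g(v))\<close>, the right-hand sum being over arcs \<open>(u, v)\<close>.
  The arcs of the token graph are the moves of one token along an arc \<open>(a, b)\<close> of \<open>G\<close>, and such a
  move changes the indicator of \<open>y\<close> by \<open>[y = a] - [y = b]\<close>. So the \<open>(x, y)\<close> entry of the left-hand
  side is the sum over the arcs \<open>(a, b)\<close> of \<open>N(x,a,b) ([y = a] - [y = b])\<close>, where \<open>N(x,a,b)\<close> counts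
  the \<open>k\<close>-subsets containing \<open>x\<close> and \<open>a\<close> but not \<open>b\<close>. For \<open>x\<close> outside \<open>{a, b}\<close> this number is
  symmetric in \<open>a\<close> and \<open>b\<close> and cancels against the reverse arc; for \<open>x = b\<close> it is zero; and for
  \<open>x = a\<close> it is \<open>(n - 2) choose (k - 1)\<close>.
\<close>

text \<open>Removing \<open>P\<close> is a bijection onto the subsets of \<open>V - P - Q\<close>
  with \<open>k - card P\<close> elements. The case distinction guards against truncated
  subtraction: for \<open>card P > k\<close> the binomial coefficient would be 1 instead of
  0.\<close>

lemma card_k_subsets_between:
  assumes "finite V" "P \<subseteq> V" "Q \<subseteq> V" "P \<inter> Q = {}"
  shows "card {A \<in> k_subsets V k. P \<subseteq> A \<and> A \<inter> Q = {}} =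
    (if card P \<le> k then (card V - card P - card Q) choose (k - card P) else 0)"
proof (cases "card P \<le> k")
  case True
  have fin: "finite A" if "A \<subseteq> V" for A
    using that assms(1) by (rule finite_subset)
  have "bij_betw (\<lambda>A. A - P) {A \<in> k_subsets V k. P \<subseteq> A \<and> A \<inter> Q = {}}
      {A. A \<subseteq> V - P - Q \<and> card A = k - card P}"
  proof (rule bij_betw_byWitness[where f' = "\<lambda>A. A \<union> P"])
    show "(\<lambda>A. A - P) ` {A \<in> k_subsets V k. P \<subseteq> A \<and> A \<inter> Q = {}}
        \<subseteq> {A. A \<subseteq> V - P - Q \<and> card A = k - card P}"
      using assms fin by (auto simp: k_subsets_def card_Diff_subset)
    show "(\<lambda>A. A \<union> P) ` {A. A \<subseteq> V - P - Q \<and> card A = k - card P}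
        \<subseteq> {A \<in> k_subsets V k. P \<subseteq> A \<and> A \<inter> Q = {}}"
    proof safe
      fix A assume A: "A \<subseteq> V - P - Q" "card A = k - card P"
      then have "card (A \<union> P) = card A + card P"
        using assms fin[of A] fin[of P] by (intro card_Un_disjoint) auto
      then show "A \<union> P \<in> k_subsets V k"
        using A True assms by (auto simp: k_subsets_def)
    qed (use assms in auto)
  qed auto
  then have "card {A \<in> k_subsets V k. P \<subseteq> A \<and> A \<inter> Q = {}} =
      card {A. A \<subseteq> V - P - Q \<and> card A = k - card P}"
    by (rule bij_betw_same_card)
  also have "\<dots> = card (V - P - Q) choose (k - card P)"
    using assms by (intro n_subsets) auto
  also have "card (V - P - Q) = card V - card P - card Q"
    using assms fin by (subst card_Diff_subset) (auto simp: card_Diff_subset)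
  finally show ?thesis using True by simp
next
  case False
  have "{A \<in> k_subsets V k. P \<subseteq> A \<and> A \<inter> Q = {}} = {}"
    using False assms(1) by (auto simp: k_subsets_def dest: card_mono[OF finite_subset])
  then show ?thesis using False by (simp only: card.empty if_False)
qed

text \<open>Row \<open>u\<close> of the Laplacian sends \<open>g\<close> to the degree of
  \<open>u\<close> times \<open>g u\<close> minus the sum of \<open>g\<close> over the neighbours,
  that is, to the sum of \<open>g u - g v\<close> over the neighbours \<open>v\<close>. Each edge
  contributes both of its arcs, so no factor 1/2 appears.\<close>

lemma laplacian_matrix_form:
  fixes f g :: "'a \<Rightarrow> real"
  assumes "pair_graph G" "distinct vs" "set vs = pverts G"
  shows "(\<Sum>i<length vs. f (vs ! i) *
      (\<Sum>j<length vs. laplacian_matrix vs G $$ (i, j) * g (vs ! j))) =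
    (\<Sum>(u, v)\<in>parcs G. f u * (g u - g v))"
proof -
  interpret pair_graph G by fact
  define V where "V = pverts G"
  define N where "N u = {v. (u, v) \<in> parcs G}" for u
  have finV: "finite V" by (simp add: V_def)
  have NV: "N u \<subseteq> V" for u
    by (auto simp: N_def V_def dest: in_arcsD2)
  have finN: "finite (N u)" for u
    using NV finV by (rule finite_subset)
  have list_sum: "(\<Sum>i<length vs. h (vs ! i)) = sum h V" for h :: "'a \<Rightarrow> real"
    using sum.reindex_bij_betw[OF bij_betw_nth[OF assms(2) refl refl], of h] assms(3)
    by (simp add: V_def)
  have deg: "out_degree (with_proj G) u = card (N u)" for u
  proof -
    have "out_arcs (with_proj G) u = Pair u ` N u"
      by (auto simp: N_def)
    then show ?thesis
      by (simp add: out_degree_def card_image inj_on_def)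
  qed
  have row: "(\<Sum>j<length vs. laplacian_matrix vs G $$ (i, j) * g (vs ! j)) =
      (\<Sum>v\<in>N (vs ! i). g (vs ! i) - g v)" if "i < length vs" for i
  proof -
    let ?u = "vs ! i"
    have "?u \<in> V" using that assms(3) V_def by auto
    \<comment> \<open>As \<open>vs\<close> is distinct, the diagonal test on positions becomes a
      test on vertices. The summand is then a function of the vertex \<open>vs ! j\<close> alone, as
      \<open>list_sum\<close> requires.\<close>
    have "(\<Sum>j<length vs. laplacian_matrix vs G $$ (i, j) * g (vs ! j)) =
        (\<Sum>j<length vs. (\<lambda>v. (if v = ?u then real (card (N ?u)) * g v else 0) -
          (if v \<in> N ?u then g v else 0)) (vs ! j))"
      using that assms(2)
      by (intro sum.cong)
        (auto simp: laplacian_matrix_def degree_matrix_def adjacency_matrix_def deg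
          nth_eq_iff_index_eq N_def algebra_simps)
    also have "\<dots> = (\<Sum>v\<in>V. (if v = ?u then real (card (N ?u)) * g v else 0) -
          (if v \<in> N ?u then g v else 0))"
      by (rule list_sum)
    also have "\<dots> = real (card (N ?u)) * g ?u - sum g (N ?u)"
      using finV \<open>?u \<in> V\<close> NV[of ?u]
      by (simp add: sum_subtractf sum.inter_restrict[symmetric] Int_absorb1)
    finally show ?thesis by (simp add: sum_subtractf)
  qed
  have "(\<Sum>i<length vs. f (vs ! i) *
      (\<Sum>j<length vs. laplacian_matrix vs G $$ (i, j) * g (vs ! j))) =
      (\<Sum>i<length vs. (\<lambda>u. \<Sum>v\<in>N u. f u * (g u - g v)) (vs ! i))"
    by (intro sum.cong) (simp_all add: row sum_distrib_left)
  also have "\<dots> = (\<Sum>u\<in>V. \<Sum>v\<in>N u. f u * (g u - g v))"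
    by (rule list_sum)
  also have "\<dots> = (\<Sum>(u, v)\<in>Sigma V N. f u * (g u - g v))"
    using finV finN by (intro sum.Sigma) auto
  also have "Sigma V N = parcs G"
    by (auto simp: N_def V_def dest: in_arcsD1)
  finally show ?thesis .
qed

text \<open>An arc of the token graph amounts to a starting set \<open>A\<close> together with the
  arc \<open>(a, b)\<close> of \<open>G\<close> along which a token leaves \<open>a\<close> and
  reaches the free vertex \<open>b\<close>; \<open>move\<close> is this bijection.\<close>

lemma sum_token_graph_arcs:
  fixes F :: "'a set \<Rightarrow> 'a set \<Rightarrow> 'b::comm_monoid_add"
  assumes "pair_graph G"
  shows "(\<Sum>(A, B)\<in>parcs (token_graph k G). F A B) =
    (\<Sum>(a, b)\<in>parcs G. \<Sum>A\<in>{A \<in> k_subsets (pverts G) k. a \<in> A \<and> b \<notin> A}.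
      F A (insert b (A - {a})))"
proof -
  interpret pair_graph G by fact
  define S where "S e = {A \<in> k_subsets (pverts G) k. fst e \<in> A \<and> snd e \<notin> A}" for e
  define move :: "('a \<times> 'a) \<times> 'a set \<Rightarrow> 'a set \<times> 'a set"
    where "move = (\<lambda>((a, b), A). (A, insert b (A - {a})))"
  have finS: "finite (S e)" for e
    by (rule finite_subset[of _ "Pow (pverts G)"]) (auto simp: S_def k_subsets_def)
  have "bij_betw move (Sigma (parcs G) S) (parcs (token_graph k G))"
    unfolding bij_betw_def
  proof
    show "inj_on move (Sigma (parcs G) S)"
    proof (rule inj_onI)
      fix p q assume pq: "p \<in> Sigma (parcs G) S" "q \<in> Sigma (parcs G) S" and "move p = move q"
      obtain a b A a' b' A' where p: "p = ((a, b), A)" and q: "q = ((a', b'), A')"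
        by (metis prod.exhaust)
      with \<open>move p = move q\<close> have eq: "move ((a, b), A) = move ((a', b'), A')" by simp
      from eq pq p q have mem: "a \<in> A" "b \<notin> A" "a' \<in> A" "b' \<notin> A"
        by (auto simp: S_def move_def)
      have diff: "insert b (A - {a}) = insert b' (A - {a'})" and "A = A'"
        using eq by (auto simp: move_def)
      \<comment> \<open>Both moves start from the same set and end in the same set. The only element
        gained is \<open>b\<close>, hence also \<open>b'\<close>; the only element lost is
        \<open>a\<close>, hence also \<open>a'\<close>.\<close>
      have "b \<in> insert b' (A - {a'})" "a \<notin> insert b' (A - {a'})"
        unfolding diff[symmetric] using mem by auto
      then have "a = a'" "b = b'" using mem by auto
      then show "p = q" using p q \<open>A = A'\<close> by simp
    qed
    show "move ` Sigma (parcs G) S = parcs (token_graph k G)"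
    proof (intro equalityI subsetI)
      fix p assume "p \<in> move ` Sigma (parcs G) S"
      then obtain a b A where ab: "(a, b) \<in> parcs G" and A: "A \<in> k_subsets (pverts G) k"
        and mem: "a \<in> A" "b \<notin> A" and p: "p = (A, insert b (A - {a}))"
        by (auto simp: S_def move_def)
      have "finite A"
        using A by (auto simp: k_subsets_def intro: finite_subset)
      then have "card (insert b (A - {a})) = card A"
        using mem card_Suc_Diff1[of A a] by simp
      then have "insert b (A - {a}) \<in> k_subsets (pverts G) k"
        using A ab by (auto simp: k_subsets_def dest: in_arcsD2)
      moreover have "sym_diff A (insert b (A - {a})) = {a, b}"
        using mem by blast
      ultimately show "p \<in> parcs (token_graph k G)"
        using A ab mem p by (auto simp: token_graph_def)
    next
      fix p assume "p \<in> parcs (token_graph k G)"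
      then obtain A B a b where p: "p = (A, B)" and A: "A \<in> k_subsets (pverts G) k"
        and mem: "a \<in> A" "b \<in> B" and sd: "sym_diff A B = {a, b}" and ab: "(a, b) \<in> parcs G"
        by (auto simp: token_graph_def)
      have "a \<noteq> b" using ab by (auto dest: no_loops)
      \<comment> \<open>An element of the symmetric difference lies in exactly one of the two
        sets.\<close>
      have "a \<notin> B" "b \<notin> A" using mem sd by blast+
      moreover have "B = insert b (A - {a})" using mem sd \<open>a \<notin> B\<close> by blast
      ultimately have "((a, b), A) \<in> Sigma (parcs G) S" "p = move ((a, b), A)"
        using p A mem ab by (auto simp: S_def move_def)
      then show "p \<in> move ` Sigma (parcs G) S" by blast
    qed
  qed
  then have "(\<Sum>(A, B)\<in>parcs (token_graph k G). F A B) =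
      (\<Sum>z\<in>Sigma (parcs G) S. case move z of (A, B) \<Rightarrow> F A B)"
    by (rule sum.reindex_bij_betw[symmetric])
  also have "\<dots> = (\<Sum>(e, A)\<in>Sigma (parcs G) S. F A (insert (snd e) (A - {fst e})))"
    by (intro sum.cong) (auto simp: move_def)
  also have "\<dots> = (\<Sum>e\<in>parcs G. \<Sum>A\<in>S e. F A (insert (snd e) (A - {fst e})))"
    using finS by (intro sum.Sigma[symmetric]) auto
  finally show ?thesis by (simp add: S_def case_prod_unfold)
qed

text \<open>Reversing arcs permutes \<open>parcs G\<close> and negates every summand, so the sum
  equals its own negative.\<close>

lemma sum_arcs_sym_antisym:
  fixes s h :: "'a \<Rightarrow> 'a \<Rightarrow> real"
  assumes "pair_graph G"
    and "\<And>a b. (a, b) \<in> parcs G \<Longrightarrow> s a b = s b a" "\<And>a b. h a b = - h b a"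
  shows "(\<Sum>(a, b)\<in>parcs G. s a b * h a b) = 0"
proof -
  interpret pair_graph G by fact
  have "(\<Sum>(a, b)\<in>parcs G. s a b * h a b) = (\<Sum>(a, b)\<in>parcs G. s b a * h b a)"
    by (rule sum.reindex_bij_witness[where i = prod.swap and j = prod.swap])
      (auto intro: arcs_symmetric)
  also have "\<dots> = (\<Sum>(a, b)\<in>parcs G. - (s a b * h a b))"
  proof (intro sum.cong refl, clarify)
    fix a b assume "(a, b) \<in> parcs G"
    then show "s b a * h b a = - (s a b * h a b)"
      using assms(2)[of a b] assms(3)[of b a] by simp
  qed
  also have "\<dots> = - (\<Sum>(a, b)\<in>parcs G. s a b * h a b)"
    by (simp add: case_prod_unfold sum_negf)
  finally show ?thesis by simp
qed

text \<open>The left-hand side is an entry of the triple matrix product in arc form. Splitting the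
  subset count into a term supported on \<open>a = x\<close> and a term symmetric in
  \<open>a\<close> and \<open>b\<close> leaves a multiple of the same form for
  \<open>G\<close>.\<close>

lemma token_graph_indicator_form:
  assumes "pair_graph G" "1 \<le> k" "x \<in> pverts G"
  shows "(\<Sum>(A, B)\<in>parcs (token_graph k G).
      of_bool (x \<in> A) * (of_bool (y \<in> A) - of_bool (y \<in> B))) =
    real ((card (pverts G) - 2) choose (k - 1)) *
      (\<Sum>(a, b)\<in>parcs G. of_bool (a = x) * (of_bool (a = y) - of_bool (b = y)))"
proof -
  interpret pair_graph G by fact
  let ?V = "pverts G"
  define M where "M = real ((card ?V - 2) choose (k - 1))"
  define h where "h a b = (of_bool (a = y) - of_bool (b = y) :: real)" for a b
  \<comment> \<open>The number of \<open>k\<close>-subsets containing \<open>x\<close> and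
    \<open>a\<close> but not \<open>b\<close>, when the three are distinct. For \<open>k = 1\<close>
    there are none, which the explicit test records because \<open>k - 2\<close> would truncate to
    0.\<close>
  define s where "s a b = (if x = a \<or> x = b then 0
      else if 2 \<le> k then real ((card ?V - 3) choose (k - 2)) else 0)" for a b
  have count: "(\<Sum>A\<in>{A \<in> k_subsets ?V k. a \<in> A \<and> b \<notin> A}. of_bool (x \<in> A)) =
      M * of_bool (a = x) + s a b" if "(a, b) \<in> parcs G" for a b
  proof -
    have ab: "a \<in> ?V" "b \<in> ?V" "a \<noteq> b"
      using that by (auto dest: in_arcsD1 in_arcsD2 no_loops)
    have "finite (k_subsets ?V k)"
      by (rule finite_subset[of _ "Pow ?V"]) (auto simp: k_subsets_def)
    then have "(\<Sum>A\<in>{A \<in> k_subsets ?V k. a \<in> A \<and> b \<notin> A}. of_bool (x \<in> A)) =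
        real (card ({A \<in> k_subsets ?V k. a \<in> A \<and> b \<notin> A} \<inter> {A. x \<in> A}))"
      by (simp add: sum.If_cases of_bool_def)
    also have "{A \<in> k_subsets ?V k. a \<in> A \<and> b \<notin> A} \<inter> {A. x \<in> A} =
        {A \<in> k_subsets ?V k. {x, a} \<subseteq> A \<and> A \<inter> {b} = {}}"
      by auto
    also have "real (card \<dots>) = M * of_bool (a = x) + s a b"
    proof (cases "x = b")
      case True
      then have "{A \<in> k_subsets ?V k. {x, a} \<subseteq> A \<and> A \<inter> {b} = {}} = {}" by auto
      then show ?thesis using True ab(3) by (simp only: card.empty) (simp add: s_def)
    next
      case False
      \<comment> \<open>For \<open>x = a\<close> the set \<open>{x, a}\<close> has one element and
        the count is \<open>M\<close>; otherwise it has two and the count is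
        \<open>s a b\<close>.\<close>
      then show ?thesis
        using ab assms(2,3) card_k_subsets_between[of ?V "{x, a}" "{b}" k]
        by (cases "x = a") (auto simp: s_def M_def numeral_2_eq_2 numeral_3_eq_3)
    qed
    finally show ?thesis .
  qed
  have "(\<Sum>(A, B)\<in>parcs (token_graph k G).
      of_bool (x \<in> A) * (of_bool (y \<in> A) - of_bool (y \<in> B) :: real)) =
      (\<Sum>(a, b)\<in>parcs G. \<Sum>A\<in>{A \<in> k_subsets ?V k. a \<in> A \<and> b \<notin> A}.
        of_bool (x \<in> A) * (of_bool (y \<in> A) - of_bool (y \<in> insert b (A - {a}))))"
    by (rule sum_token_graph_arcs[OF assms(1)])
  \<comment> \<open>Since \<open>a \<in> A\<close> and \<open>b \<notin> A\<close>, the change in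
    the indicator of \<open>y\<close> does not depend on \<open>A\<close> and can be factored out of
    the inner sum.\<close>
  also have "\<dots> = (\<Sum>(a, b)\<in>parcs G. \<Sum>A\<in>{A \<in> k_subsets ?V k. a \<in> A \<and> b \<notin> A}.
        of_bool (x \<in> A) * h a b)"
    by (auto simp: h_def intro!: sum.cong)
  also have "\<dots> = (\<Sum>(a, b)\<in>parcs G. M * (of_bool (a = x) * h a b) + s a b * h a b)"
  proof (intro sum.cong refl, clarify)
    fix a b assume "(a, b) \<in> parcs G"
    then show "(\<Sum>A\<in>{A \<in> k_subsets ?V k. a \<in> A \<and> b \<notin> A}. of_bool (x \<in> A) * h a b) =
        M * (of_bool (a = x) * h a b) + s a b * h a b"
      by (simp only: sum_distrib_right[symmetric] count) (simp only: distrib_right mult.assoc)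
  qed
  also have "\<dots> = M * (\<Sum>(a, b)\<in>parcs G. of_bool (a = x) * h a b) +
      (\<Sum>(a, b)\<in>parcs G. s a b * h a b)"
    unfolding case_prod_unfold by (simp only: sum.distrib sum_distrib_left)
  also have "(\<Sum>(a, b)\<in>parcs G. s a b * h a b) = 0"
    using assms(1) by (rule sum_arcs_sym_antisym) (auto simp: s_def h_def)
  finally show ?thesis by (simp add: M_def h_def)
qed

text \<open>Indicators of the two vertices, put into \<open>laplacian_matrix_form\<close>, pick out
  a single entry.\<close>

lemma laplacian_matrix_entry:
  assumes "pair_graph G" "distinct vs" "set vs = pverts G" "i < length vs" "j < length vs"
  shows "laplacian_matrix vs G $$ (i, j) =
    (\<Sum>(a, b)\<in>parcs G. of_bool (a = vs ! i) * (of_bool (a = vs ! j) - of_bool (b = vs ! j)))"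
proof -
  have "(\<Sum>(a, b)\<in>parcs G. of_bool (a = vs ! i) *
        (of_bool (a = vs ! j) - of_bool (b = vs ! j) :: real)) =
      (\<Sum>i'<length vs. of_bool (vs ! i' = vs ! i) *
        (\<Sum>j'<length vs. laplacian_matrix vs G $$ (i', j') * of_bool (vs ! j' = vs ! j)))"
    using laplacian_matrix_form[OF assms(1-3), of "\<lambda>v. of_bool (v = vs ! i)"
        "\<lambda>v. of_bool (v = vs ! j)"] by simp
  also have "\<dots> = (\<Sum>i'<length vs. if i' = i then
        (\<Sum>j'<length vs. if j' = j then laplacian_matrix vs G $$ (i', j') else 0) else 0)"
    using assms by (intro sum.cong) (auto simp: nth_eq_iff_index_eq intro!: sum.cong)
  finally show ?thesis using assms by simp
qed

theorem theorem3p3: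
  fixes G :: "nat pair_pre_digraph" and n k :: nat and As :: "nat set list"
  assumes "pair_graph G" and "pverts G = {1..n}"
    and "1 \<le> k" and "real k \<le> real n / 2"
    and "distinct As" and "set As = k_subsets {1..n} k"
  shows "transpose_mat (binomial_matrix n k As) * laplacian_matrix As (token_graph k G)
           * binomial_matrix n k As
         = real ((n - 2) choose (k - 1)) \<cdot>\<^sub>m laplacian_matrix [1..<Suc n] G"
proof -
  let ?B = "binomial_matrix n k As"
  let ?L = "laplacian_matrix As (token_graph k G)"
  let ?L1 = "laplacian_matrix [1..<Suc n] G"
  have len: "length As = n choose k"
    using distinct_card[OF assms(5)] assms(6) n_subsets[of "{1..n}" k]
    by (simp add: k_subsets_def)
  have B: "?B \<in> carrier_mat (length As) n"
    by (simp add: binomial_matrix_def len)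
  have L: "?L \<in> carrier_mat (length As) (length As)"
    by (auto simp: laplacian_matrix_def degree_matrix_def adjacency_matrix_def)
  have L1: "?L1 \<in> carrier_mat n n"
    by (auto simp: laplacian_matrix_def degree_matrix_def adjacency_matrix_def)
  have Bentry: "?B $$ (i, j) = of_bool (Suc j \<in> As ! i)" if "i < length As" "j < n" for i j
    using that by (simp add: binomial_matrix_def len)
  \<comment> \<open>Bracketed to the right, the \<open>(x, y)\<close> entry has the shape of
    \<open>laplacian_matrix_form\<close>, with columns \<open>x\<close> and \<open>y\<close> of
    \<open>?B\<close> as the functions \<open>f\<close> and \<open>g\<close>.\<close>
  have "transpose_mat ?B * (?L * ?B) = real ((n - 2) choose (k - 1)) \<cdot>\<^sub>m ?L1"
  proof (rule eq_matI)
    fix x y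
    assume "x < dim_row (real ((n - 2) choose (k - 1)) \<cdot>\<^sub>m ?L1)"
      and "y < dim_col (real ((n - 2) choose (k - 1)) \<cdot>\<^sub>m ?L1)"
    then have xy: "x < n" "y < n" using L1 by auto
    have "(transpose_mat ?B * (?L * ?B)) $$ (x, y) =
        (\<Sum>i<length As. of_bool (Suc x \<in> As ! i) *
          (\<Sum>j<length As. ?L $$ (i, j) * of_bool (Suc y \<in> As ! j)))"
      using B L xy
      by (auto simp: scalar_prod_def Bentry lessThan_atLeast0 intro!: sum.cong)
    also have "\<dots> = (\<Sum>(A, C)\<in>parcs (token_graph k G).
        of_bool (Suc x \<in> A) * (of_bool (Suc y \<in> A) - of_bool (Suc y \<in> C)))"
      using assms by (intro laplacian_matrix_form pair_graph_token_graph)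
        (auto simp: token_graph_def)
    also have "\<dots> = real ((n - 2) choose (k - 1)) * (\<Sum>(a, b)\<in>parcs G.
        of_bool (a = Suc x) * (of_bool (a = Suc y) - of_bool (b = Suc y)))"
      using token_graph_indicator_form[OF assms(1,3), of "Suc x" "Suc y"] assms(2) xy by simp
    \<comment> \<open>Position \<open>x\<close> of \<open>[1..<Suc n]\<close> holds the vertex
      \<open>Suc x\<close>, the element to which column \<open>x\<close> of \<open>?B\<close>
      belongs.\<close>
    also have "\<dots> = (real ((n - 2) choose (k - 1)) \<cdot>\<^sub>m ?L1) $$ (x, y)"
      using laplacian_matrix_entry[OF assms(1), of "[1..<Suc n]" x y] assms(2) xy L1
      by (simp del: upt_Suc add: atLeastLessThanSuc_atLeastAtMost)
    finally show "(transpose_mat ?B * (?L * ?B)) $$ (x, y) =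
        (real ((n - 2) choose (k - 1)) \<cdot>\<^sub>m ?L1) $$ (x, y)" .
  qed (use B L1 in auto)
  moreover have "transpose_mat ?B * ?L * ?B = transpose_mat ?B * (?L * ?B)"
    using B L by (intro assoc_mult_mat) auto
  ultimately show ?thesis by simp
qed

end
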